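(* Let $\mathcal{H}$ be a separable Hilbert space, let $K\in\mathcal{L}(\mathcal{H})$, let $\{(\mathcal{W}_i,w_i)\}_{i\in I}$ be a $K$-fusion frame for $\mathcal{H}$ and let $\mathcal{V}$ be a closed subspace of $\mathcal{H}$. Assume that $P_{\mathcal{V}}$ commutes with $P_{\mathcal{W}_i}$ for each $i\in I$ and that $P_{\mathcal{V}}^{\dagger}$ commutes with $K^*$. Then $\{(\mathcal{W}_i\cap\mathcal{V},w_i)\}_{i\in I}$ is a $K$-fusion frame for $R(P_{\mathcal{V}})$; that is, there exist $A',B'>0$ such that for all $f\in R(P_{\mathcal{V}})$, $$A'\|K^*f\|^2\le\sum_{i\in I}w_i^2\|P_{\mathcal{W}_i\cap\mathcal{V}}f\|^2\le B'\|f\|^2.$$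
   Context: The index set $I$ is finite or countable. $\mathcal{L}(\mathcal{H})$ is the space of bounded linear operators on $\mathcal{H}$; $R(T)$ and $N(T)$ are range and null space of $T$; $P_{\mathcal{W}}$ denotes the orthogonal projection of $\mathcal{H}$ onto the closed subspace $\mathcal{W}$. For $T\in\mathcal{L}(\mathcal{H})$ with closed range, $T^\dagger\in\mathcal{L}(\mathcal{H})$ is the Moore–Penrose pseudo-inverse, the unique operator with $N(T^\dagger)=N(T^* )$, $R(T^\dagger)=R(T^* )$, $TT^\dagger=P_{R(T)}$, $T^\dagger T=P_{R(T^* )}$. For closed subspaces $\mathcal{W}_i$ of $\mathcal{H}$ and positive weights $w_i$, $\{(\mathcal{W}_i,w_i)\}_{i\in I}$ is a $K$-fusion frame for $\mathcal{H}$ if there are $A,B>0$ with $A\|K^*f\|^2\le\sum_{i\in I}w_i^2\|P_{\mathcal{W}_i}f\|^2\le B\|f\|^2$ for all $f\in\mathcal{H}$. *)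

theory Defs
  imports "HOL-Analysis.Analysis"
begin

text \<open>
  Hilbert spaces over \<open>\<real>\<close> and over \<open>\<complex>\<close> are treated uniformly: by the theorem of Gelfand and
  Mazur, \<open>\<real>\<close> and \<open>\<complex>\<close> are, up to isomorphism, the only instances of \<^class>\<open>real_normed_field\<close>.
  Conjugation is recovered from \<open>conj z * z = \<bar>z\<bar>\<^sup>2\<close> (with \<open>conj 0 = 0\<close> because \<open>x / 0 = 0\<close>).
\<close>

definition sconj :: "'k::real_normed_field \<Rightarrow> 'k"
  where "sconj z = of_real ((norm z)\<^sup>2) / z"

lemma sconj_complex: "sconj z = cnj z" for z :: complex
  by (cases "z = 0") (simp_all add: sconj_def complex_norm_square del: of_real_power)

lemma sconj_real: "sconj x = x" for x :: real
  by (simp add: sconj_def power2_eq_square)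

text \<open>
  The norm, the topology and completeness are those of the class \<^class>\<open>banach\<close>; the axioms say
  that the norm is the one induced by the inner product, which is linear in its first argument.
\<close>

locale hilbert_space = vector_space smul
  for smul :: "'k::real_normed_field \<Rightarrow> 'h::banach \<Rightarrow> 'h" +
  fixes ip :: "'h \<Rightarrow> 'h \<Rightarrow> 'k"
  assumes scale_of_real: "smul (of_real r) x = r *\<^sub>R x"
    and ip_add_left: "ip (x + y) z = ip x z + ip y z"
    and ip_scale_left: "ip (smul c x) z = c * ip x z"
    and ip_commute: "ip y x = sconj (ip x y)"
    and ip_self: "ip x x = of_real ((norm x)\<^sup>2)"

lemma hilbert_space_real:
  "hilbert_space scaleR (inner :: 'a::{real_inner, banach} \<Rightarrow> 'a \<Rightarrow> real)"
  by unfold_locales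
    (auto simp: scaleR_add_right scaleR_add_left inner_add_left sconj_real
      power2_norm_eq_inner intro: inner_commute)

lemma hilbert_space_complex: "hilbert_space (*) (\<lambda>x y :: complex. x * cnj y)"
  by unfold_locales
    (auto simp: algebra_simps scaleR_conv_of_real sconj_complex complex_norm_square
      simp del: of_real_power)

definition closed_subspace :: "('k::real_normed_field \<Rightarrow> 'h::banach \<Rightarrow> 'h) \<Rightarrow> 'h set \<Rightarrow> bool"
  where "closed_subspace smul W \<longleftrightarrow> module.subspace smul W \<and> closed W"

definition bounded_op :: "('k::real_normed_field \<Rightarrow> 'h::banach \<Rightarrow> 'h) \<Rightarrow> ('h \<Rightarrow> 'h) \<Rightarrow> bool"
  where "bounded_op smul T \<longleftrightarrow>
    Vector_Spaces.linear smul smul T \<and> (\<exists>B. \<forall>x. norm (T x) \<le> B * norm x)"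

definition adj_op :: "('h::banach \<Rightarrow> 'h \<Rightarrow> 'k::real_normed_field) \<Rightarrow> ('h \<Rightarrow> 'h) \<Rightarrow> 'h \<Rightarrow> 'h"
  where "adj_op ip T = (THE S. \<forall>x y. ip (T x) y = ip x (S y))"

definition orth_proj :: "('h::banach \<Rightarrow> 'h \<Rightarrow> 'k::real_normed_field) \<Rightarrow> 'h set \<Rightarrow> 'h \<Rightarrow> 'h"
  where "orth_proj ip W f = (THE p. p \<in> W \<and> (\<forall>v\<in>W. ip (f - p) v = 0))"

text \<open>The Moore-Penrose pseudo-inverse; meaningful for bounded operators with closed range.\<close>

definition pseudo_inverse ::
  "('k::real_normed_field \<Rightarrow> 'h::banach \<Rightarrow> 'h) \<Rightarrow> ('h \<Rightarrow> 'h \<Rightarrow> 'k) \<Rightarrow> ('h \<Rightarrow> 'h) \<Rightarrow> 'h \<Rightarrow> 'h"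
  where "pseudo_inverse smul ip T = (THE S.
    bounded_op smul S \<and>
    {x. S x = 0} = {x. adj_op ip T x = 0} \<and>
    range S = range (adj_op ip T) \<and>
    T \<circ> S = orth_proj ip (range T) \<and>
    S \<circ> T = orth_proj ip (range (adj_op ip T)))"

text \<open>
  \<open>K\<close>-fusion frames for a closed subspace \<open>M\<close> of the ambient space (\<open>M = UNIV\<close> being the usual
  notion); \<open>K\<^sup>*\<close> is the adjoint taken in the ambient space. Summability has to be required
  separately, since \<^const>\<open>infsum\<close> is 0 for families that are not summable.
\<close>

definition K_fusion_frame ::
  "('k::real_normed_field \<Rightarrow> 'h::banach \<Rightarrow> 'h) \<Rightarrow> ('h \<Rightarrow> 'h \<Rightarrow> 'k) \<Rightarrow> 'h set \<Rightarrow> ('h \<Rightarrow> 'h) \<Rightarrow>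
    'i set \<Rightarrow> ('i \<Rightarrow> 'h set) \<Rightarrow> ('i \<Rightarrow> real) \<Rightarrow> bool"
  where "K_fusion_frame smul ip M K I W w \<longleftrightarrow>
    (\<forall>i\<in>I. closed_subspace smul (W i) \<and> W i \<subseteq> M \<and> 0 < w i) \<and>
    (\<exists>A>0. \<exists>B>0. \<forall>f\<in>M.
      (\<lambda>i. (w i)\<^sup>2 * (norm (orth_proj ip (W i) f))\<^sup>2) summable_on I \<and>
      A * (norm (adj_op ip K f))\<^sup>2 \<le> (\<Sum>\<^sub>\<infinity>i\<in>I. (w i)\<^sup>2 * (norm (orth_proj ip (W i) f))\<^sup>2) \<and>
      (\<Sum>\<^sub>\<infinity>i\<in>I. (w i)\<^sup>2 * (norm (orth_proj ip (W i) f))\<^sup>2) \<le> B * (norm f)\<^sup>2)"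

end

(* If P_V commutes with P_W then, for f in V, P_W f = P_W (P_V f) = P_V (P_W f) lies in V, so it is
   also the projection of f onto the intersection of W and V. The frame inequalities on R(P_V) = V
   are therefore those of the given frame, with the same bounds.

   Additivity of sconj on the abstract scalar field is not immediate (it would follow from the
   Gelfand-Mazur theorem), so the parallelogram law is avoided in constructing projections: a
   minimizing sequence for the distance from f to W is Cauchy because its residuals are almost
   orthogonal to W, which needs additivity of the inner product in the first argument only. *)

theory Submission
  imports Defs
begin

context hilbert_space
begin

lemma ip_diff_left: "ip (x - y) z = ip x z - ip y z"
  using ip_add_left[of "x - y" y z] by simp

lemma ip_eq_zero_commute: "ip x y = 0 \<Longrightarrow> ip y x = 0"
  using ip_commute[of y x] by (simp add: sconj_def)

lemma ip_zero_right: "ip x 0 = 0"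
proof (rule ip_eq_zero_commute)
  show "ip 0 x = 0" using ip_diff_left[of 0 0 x] by simp
qed

lemma ip_self_commuted: "sconj (ip x x) = ip x x"
  by (rule ip_commute[symmetric])

text \<open>Orthogonality removes the cross terms from \<open>ip (x + y) x\<close> and
  \<open>ip (x + y) y\<close> before the arguments are swapped. Thus \<open>sconj\<close> acts only
  on \<open>ip x x\<close> and \<open>ip y y\<close>, which it fixes, and no expansion in the second
  argument occurs.\<close>

lemma ip_pythagoras:
  assumes "ip x y = 0"
  shows "(norm (x + y))\<^sup>2 = (norm x)\<^sup>2 + (norm y)\<^sup>2"
proof -
  have yx: "ip y x = 0" using assms by (rule ip_eq_zero_commute)
  have "ip x (x + y) = ip x x" "ip y (x + y) = ip y y"
    using ip_commute[of x "x + y"] ip_commute[of y "x + y"] assms yx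
    by (simp_all add: ip_add_left ip_self_commuted)
  then have "ip (x + y) (x + y) = ip x x + ip y y"
    by (simp add: ip_add_left)
  then have "(of_real ((norm (x + y))\<^sup>2) :: 'k) = of_real ((norm x)\<^sup>2 + (norm y)\<^sup>2)"
    by (simp add: ip_self)
  then show ?thesis by (simp only: of_real_eq_iff)
qed

text \<open>The axiom \<open>scale_of_real\<close> settles real scalars only. For general
  \<open>c\<close> the squared norm is read off from \<open>ip_self\<close>, by evaluating the
  quotient that defines \<open>sconj\<close>.\<close>

lemma norm_smul: "norm (smul c x) = norm c * norm x"
proof -
  have "ip x (smul c x) = sconj (c * of_real ((norm x)\<^sup>2))"
    using ip_commute[of x "smul c x"] by (simp add: ip_scale_left ip_self)
  then have "ip (smul c x) (smul c x) = c * sconj (c * of_real ((norm x)\<^sup>2))"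
    by (simp add: ip_scale_left)
  also have "\<dots> = of_real ((norm c * norm x)\<^sup>2)"
    \<comment> \<open>The denominator in \<open>sconj\<close> cancels when \<open>c\<close> and
      \<open>x\<close> are nonzero; otherwise both sides are 0.\<close>
    by (cases "c = 0 \<or> x = 0")
      (auto simp: sconj_def norm_mult norm_power field_simps power2_eq_square)
  finally have "(of_real ((norm (smul c x))\<^sup>2) :: 'k) = of_real ((norm c * norm x)\<^sup>2)"
    by (simp only: ip_self)
  then have "(norm (smul c x))\<^sup>2 = (norm c * norm x)\<^sup>2"
    by (simp only: of_real_eq_iff)
  then show ?thesis
    by (simp add: power2_eq_iff_nonneg)
qed

text \<open>Moving from \<open>x\<close> along \<open>v\<close> by the best multiple stays in
  \<open>W\<close> and lowers the squared distance to \<open>f\<close> by the squared norm of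
  \<open>ip (f - x) v\<close> divided by that of \<open>v\<close>. This gain cannot exceed the
  excess over the lower bound \<open>d\<close>.\<close>

lemma norm_ip_residual_le:
  assumes W: "subspace W" "x \<in> W" "v \<in> W"
    and d: "\<And>p. p \<in> W \<Longrightarrow> d \<le> (norm (f - p))\<^sup>2"
  shows "(norm (ip (f - x) v))\<^sup>2 \<le> ((norm (f - x))\<^sup>2 - d) * (norm v)\<^sup>2"
proof (cases "v = 0")
  case True
  then show ?thesis by (simp add: ip_zero_right)
next
  case False
  \<comment> \<open>The coefficient of the projection of \<open>f - x\<close> onto the line spanned
    by \<open>v\<close>.\<close>
  define c where "c = ip (f - x) v / of_real ((norm v)\<^sup>2)"
  have "ip (f - (x + smul c v)) v = 0"
    using False ip_diff_left[of "f - x" "smul c v" v]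
    by (simp add: diff_diff_eq ip_scale_left ip_self c_def)
  \<comment> \<open>Scalars are extracted from the first argument, so the orthogonality is turned
    around, scaled by \<open>c\<close> and turned back.\<close>
  then have "ip v (f - (x + smul c v)) = 0"
    by (rule ip_eq_zero_commute)
  then have "ip (smul c v) (f - (x + smul c v)) = 0"
    by (simp add: ip_scale_left)
  then have "ip (f - (x + smul c v)) (smul c v) = 0"
    by (rule ip_eq_zero_commute)
  from ip_pythagoras[OF this]
  have "(norm (f - x))\<^sup>2 = (norm (f - (x + smul c v)))\<^sup>2 + (norm c * norm v)\<^sup>2"
    by (simp add: norm_smul algebra_simps)
  moreover have "x + smul c v \<in> W"
    using W by (intro subspace_add subspace_scale)
  ultimately have "(norm c * norm v)\<^sup>2 \<le> (norm (f - x))\<^sup>2 - d"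
    using d by fastforce
  moreover have "(norm (ip (f - x) v))\<^sup>2 = (norm c * norm v)\<^sup>2 * (norm v)\<^sup>2"
    using False by (simp add: c_def norm_divide norm_mult power2_eq_square)
  ultimately show ?thesis
    by (simp add: mult_right_mono)
qed

text \<open>With \<open>v = x - y\<close>, \<open>ip v v\<close> is the difference of
  \<open>ip (f - y) v\<close> and \<open>ip (f - x) v\<close>. Each has norm at most
  \<open>e * norm v\<close> by almost-orthogonality of the residuals, and one factor
  \<open>norm v\<close> cancels.\<close>

lemma near_minimizers_close:
  assumes W: "subspace W" "x \<in> W" "y \<in> W"
    and d: "\<And>p. p \<in> W \<Longrightarrow> d \<le> (norm (f - p))\<^sup>2"
    and e: "0 \<le> e" "(norm (f - x))\<^sup>2 \<le> d + e\<^sup>2" "(norm (f - y))\<^sup>2 \<le> d + e\<^sup>2"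
  shows "norm (x - y) \<le> 2 * e"
proof -
  define v where "v = x - y"
  have v: "v \<in> W" using W by (simp add: v_def subspace_diff)
  have bound: "norm (ip (f - z) v) \<le> e * norm v"
    if "z \<in> W" "(norm (f - z))\<^sup>2 \<le> d + e\<^sup>2" for z
  proof -
    have "(norm (ip (f - z) v))\<^sup>2 \<le> ((norm (f - z))\<^sup>2 - d) * (norm v)\<^sup>2"
      using W(1) that(1) v d by (rule norm_ip_residual_le)
    also have "\<dots> \<le> e\<^sup>2 * (norm v)\<^sup>2"
      using that(2) by (intro mult_right_mono) auto
    finally have "(norm (ip (f - z) v))\<^sup>2 \<le> (e * norm v)\<^sup>2"
      by (simp add: power_mult_distrib)
    then show ?thesis
      using e(1) by (simp add: power2_le_iff_abs_le)
  qed
  have "ip v v = ip (f - y) v - ip (f - x) v"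
    by (simp add: v_def flip: ip_diff_left)
  then have "norm (ip v v) \<le> norm (ip (f - y) v) + norm (ip (f - x) v)"
    by (simp add: norm_triangle_ineq4)
  also have "\<dots> \<le> e * norm v + e * norm v"
    using W e by (intro add_mono bound)
  finally have "norm v * norm v \<le> (2 * e) * norm v"
    by (simp add: ip_self power2_eq_square norm_mult)
  then show ?thesis
    using e(1) by (cases "v = 0") (auto simp: v_def)
qed

lemma orth_proj_exists:
  assumes "closed_subspace smul W"
  shows "\<exists>p\<in>W. \<forall>v\<in>W. ip (f - p) v = 0"
proof -
  have W: "subspace W" "closed W"
    using assms by (auto simp: closed_subspace_def)
  define S where "S = (\<lambda>p. (norm (f - p))\<^sup>2) ` W"
  have S: "S \<noteq> {}" "bdd_below S"
    using subspace_0[OF W(1)] by (auto simp: S_def intro: bdd_belowI2[where m = 0])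
  have d: "Inf S \<le> (norm (f - p))\<^sup>2" if "p \<in> W" for p
    using S that by (intro cInf_lower) (auto simp: S_def)
  \<comment> \<open>\<open>Inf S\<close> is a squared distance; squaring the tolerance as well makes
    it the \<open>e\<^sup>2\<close> of \<open>near_minimizers_close\<close>, so the points
    themselves get close at the rate of \<open>inverse (real (Suc n))\<close>.\<close>
  have "\<exists>p\<in>W. (norm (f - p))\<^sup>2 < Inf S + (inverse (real (Suc n)))\<^sup>2" for n
    using cInf_less_iff[OF S, of "Inf S + (inverse (real (Suc n)))\<^sup>2"] by (auto simp: S_def)
  then obtain x where x: "\<And>n. x n \<in> W"
    "\<And>n. (norm (f - x n))\<^sup>2 < Inf S + (inverse (real (Suc n)))\<^sup>2"
    by metis
  have close: "norm (x m - x n) \<le> 2 * inverse (real (Suc N))" if "N \<le> m" "N \<le> n" for m n N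
  proof (rule near_minimizers_close[OF W(1) x(1) x(1) d])
    have "(norm (f - x k))\<^sup>2 \<le> Inf S + (inverse (real (Suc N)))\<^sup>2" if "N \<le> k" for k
    proof -
      have "(inverse (real (Suc k)))\<^sup>2 \<le> (inverse (real (Suc N)))\<^sup>2"
        using that by (intro power_mono le_imp_inverse_le) auto
      then show ?thesis using x(2)[of k] by linarith
    qed
    then show "(norm (f - x m))\<^sup>2 \<le> Inf S + (inverse (real (Suc N)))\<^sup>2"
      "(norm (f - x n))\<^sup>2 \<le> Inf S + (inverse (real (Suc N)))\<^sup>2"
      using that by auto
  qed auto
  have "Cauchy x"
  proof (rule CauchyI)
    fix e :: real
    assume "0 < e"
    then obtain N where "inverse (real (Suc N)) < e / 2"
      using reals_Archimedean[of "e / 2"] by auto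
    then show "\<exists>M. \<forall>m\<ge>M. \<forall>n\<ge>M. norm (x m - x n) < e"
      using close by (intro exI[of _ N]) force
  qed
  then obtain p where p: "x \<longlonglongrightarrow> p"
    by (auto simp: Cauchy_convergent_iff convergent_def)
  have pW: "p \<in> W"
    using W(2) x(1) p by (auto simp: closed_sequential_limits)
  have "(\<lambda>n. (norm (f - x n))\<^sup>2) \<longlonglongrightarrow> (norm (f - p))\<^sup>2"
    by (intro tendsto_intros p)
  moreover have "(\<lambda>n. Inf S + (inverse (real (Suc n)))\<^sup>2) \<longlonglongrightarrow> Inf S + 0\<^sup>2"
    by (intro tendsto_intros LIMSEQ_inverse_real_of_nat)
  ultimately have "(norm (f - p))\<^sup>2 \<le> Inf S + 0\<^sup>2"
    by (rule LIMSEQ_le) (use x(2) less_imp_le in blast)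
  then have min: "(norm (f - p))\<^sup>2 \<le> Inf S" by simp
  \<comment> \<open>The limit \<open>p\<close> attains the infimum, so its excess is 0 and the
    residual bound becomes exact orthogonality.\<close>
  have "ip (f - p) v = 0" if "v \<in> W" for v
  proof -
    have "(norm (ip (f - p) v))\<^sup>2 \<le> ((norm (f - p))\<^sup>2 - Inf S) * (norm v)\<^sup>2"
      using W(1) pW that d by (rule norm_ip_residual_le)
    also have "\<dots> \<le> 0"
      using min by (intro mult_nonpos_nonneg) auto
    finally show ?thesis by simp
  qed
  then show ?thesis using pW by blast
qed

text \<open>The difference of two candidates lies in \<open>W\<close> and is orthogonal to itself,
  hence 0. This uniqueness gives the definite description in \<open>orth_proj\<close> its
  value.\<close>

lemma orth_proj_eqI:
  assumes W: "subspace W" and p: "p \<in> W" "\<And>v. v \<in> W \<Longrightarrow> ip (f - p) v = 0"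
  shows "orth_proj ip W f = p"
  unfolding orth_proj_def
proof (rule the_equality)
  fix q
  assume q: "q \<in> W \<and> (\<forall>v\<in>W. ip (f - q) v = 0)"
  have "p - q \<in> W" using W p(1) q by (simp add: subspace_diff)
  then have "ip (f - q) (p - q) - ip (f - p) (p - q) = 0"
    using p(2) q by simp
  then have "ip (p - q) (p - q) = 0"
    by (simp flip: ip_diff_left)
  then show "q = p" by (simp add: ip_self)
qed (use p in auto)

lemma
  assumes "closed_subspace smul W"
  shows orth_proj_in: "orth_proj ip W f \<in> W"
    and orth_proj_orthogonal: "v \<in> W \<Longrightarrow> ip (f - orth_proj ip W f) v = 0"
proof -
  obtain p where p: "p \<in> W" "\<And>v. v \<in> W \<Longrightarrow> ip (f - p) v = 0"
    using orth_proj_exists[OF assms, of f] by blast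
  moreover have "subspace W" using assms by (simp add: closed_subspace_def)
  ultimately have "orth_proj ip W f = p" by (intro orth_proj_eqI)
  with p show "orth_proj ip W f \<in> W" "v \<in> W \<Longrightarrow> ip (f - orth_proj ip W f) v = 0"
    by simp_all
qed

lemma orth_proj_ident: "subspace W \<Longrightarrow> f \<in> W \<Longrightarrow> orth_proj ip W f = f"
  using ip_diff_left[of 0 0] by (intro orth_proj_eqI) auto

text \<open>Each vector of \<open>W\<close> is its own projection. Applied to \<open>V\<close>, this
  lets the frame condition be checked on \<open>V\<close> itself.\<close>

lemma range_orth_proj:
  assumes "closed_subspace smul W"
  shows "range (orth_proj ip W) = W"
proof -
  have "subspace W" using assms by (simp add: closed_subspace_def)
  then have "f \<in> range (orth_proj ip W)" if "f \<in> W" for f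
    using that by (intro range_eqI[of _ _ f]) (simp add: orth_proj_ident)
  then show ?thesis
    using orth_proj_in[OF assms] by blast
qed

lemma closed_subspace_Int:
  "closed_subspace smul U \<Longrightarrow> closed_subspace smul W \<Longrightarrow> closed_subspace smul (U \<inter> W)"
  by (auto simp: closed_subspace_def subspace_inter)

text \<open>The projection onto \<open>W\<close> meets the characterization for the smaller
  subspace: commutation puts it into \<open>V\<close>, because \<open>f\<close> is fixed by the
  projection onto \<open>V\<close>, and orthogonality to \<open>W\<close> restricts to
  \<open>W \<inter> V\<close>.\<close>

lemma orth_proj_Int_commuting:
  assumes W: "closed_subspace smul W" and V: "closed_subspace smul V"
    and comm: "orth_proj ip V \<circ> orth_proj ip W = orth_proj ip W \<circ> orth_proj ip V"
    and f: "f \<in> V"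
  shows "orth_proj ip (W \<inter> V) f = orth_proj ip W f"
proof (rule orth_proj_eqI)
  show "subspace (W \<inter> V)"
    using closed_subspace_Int[OF W V] by (simp add: closed_subspace_def)
  have "orth_proj ip V f = f"
    using V f by (simp add: closed_subspace_def orth_proj_ident)
  then have "orth_proj ip W f = orth_proj ip V (orth_proj ip W f)"
    using fun_cong[OF comm, of f] by simp
  then have "orth_proj ip W f \<in> V"
    using orth_proj_in[OF V] by metis
  then show "orth_proj ip W f \<in> W \<inter> V"
    using orth_proj_in[OF W] by blast
qed (use orth_proj_orthogonal[OF W] in blast)

end

theorem theorem4p13:
  fixes smul :: "'k::real_normed_field \<Rightarrow> 'h::banach \<Rightarrow> 'h"
    and ip :: "'h \<Rightarrow> 'h \<Rightarrow> 'k"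
    and K :: "'h \<Rightarrow> 'h"
    and I :: "'i set"
    and W :: "'i \<Rightarrow> 'h set"
    and w :: "'i \<Rightarrow> real"
    and V :: "'h set"
  assumes "hilbert_space smul ip"
    and "\<exists>D :: 'h set. countable D \<and> closure D = UNIV"
    and "bounded_op smul K"
    and "countable I"
    and "K_fusion_frame smul ip UNIV K I W w"
    and "closed_subspace smul V"
    and "\<And>i. i \<in> I \<Longrightarrow>
      orth_proj ip V \<circ> orth_proj ip (W i) = orth_proj ip (W i) \<circ> orth_proj ip V"
    and "pseudo_inverse smul ip (orth_proj ip V) \<circ> adj_op ip K =
      adj_op ip K \<circ> pseudo_inverse smul ip (orth_proj ip V)"
  shows "K_fusion_frame smul ip (range (orth_proj ip V)) K I (\<lambda>i. W i \<inter> V) w"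
proof -
  interpret hilbert_space smul ip by fact
  have V: "closed_subspace smul V" by fact
  have W: "closed_subspace smul (W i)" "0 < w i" if "i \<in> I" for i
    using assms(5) that by (auto simp: K_fusion_frame_def)
  have proj: "orth_proj ip (W i \<inter> V) f = orth_proj ip (W i) f" if "i \<in> I" "f \<in> V" for i f
    using that by (intro orth_proj_Int_commuting W V assms(7))
  \<comment> \<open>The families agree term by term on \<open>I\<close>. Summability is transferred
    along with the value, as \<open>infsum\<close> alone would not detect its failure.\<close>
  have cong: "(\<lambda>i. (w i)\<^sup>2 * (norm (orth_proj ip (W i \<inter> V) f))\<^sup>2) summable_on I \<longleftrightarrow>
      (\<lambda>i. (w i)\<^sup>2 * (norm (orth_proj ip (W i) f))\<^sup>2) summable_on I"
    "(\<Sum>\<^sub>\<infinity>i\<in>I. (w i)\<^sup>2 * (norm (orth_proj ip (W i \<inter> V) f))\<^sup>2) =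
      (\<Sum>\<^sub>\<infinity>i\<in>I. (w i)\<^sup>2 * (norm (orth_proj ip (W i) f))\<^sup>2)" if "f \<in> V" for f
    by (rule summable_on_cong infsum_cong, simp add: proj that)+
  obtain A B where AB: "0 < A" "0 < B" and frame:
    "\<forall>f\<in>UNIV. (\<lambda>i. (w i)\<^sup>2 * (norm (orth_proj ip (W i) f))\<^sup>2) summable_on I \<and>
      A * (norm (adj_op ip K f))\<^sup>2 \<le> (\<Sum>\<^sub>\<infinity>i\<in>I. (w i)\<^sup>2 * (norm (orth_proj ip (W i) f))\<^sup>2) \<and>
      (\<Sum>\<^sub>\<infinity>i\<in>I. (w i)\<^sup>2 * (norm (orth_proj ip (W i) f))\<^sup>2) \<le> B * (norm f)\<^sup>2"
    using assms(5) unfolding K_fusion_frame_def by (elim conjE exE)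
  show ?thesis
    unfolding K_fusion_frame_def range_orth_proj[OF V]
  proof (intro conjI ballI)
    show "\<exists>A>0. \<exists>B>0. \<forall>f\<in>V.
        (\<lambda>i. (w i)\<^sup>2 * (norm (orth_proj ip (W i \<inter> V) f))\<^sup>2) summable_on I \<and>
        A * (norm (adj_op ip K f))\<^sup>2 \<le> (\<Sum>\<^sub>\<infinity>i\<in>I. (w i)\<^sup>2 * (norm (orth_proj ip (W i \<inter> V) f))\<^sup>2) \<and>
        (\<Sum>\<^sub>\<infinity>i\<in>I. (w i)\<^sup>2 * (norm (orth_proj ip (W i \<inter> V) f))\<^sup>2) \<le> B * (norm f)\<^sup>2"
    proof (rule exI[of _ A], rule conjI[OF AB(1)], rule exI[of _ B], rule conjI[OF AB(2)], rule ballI)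
      fix f
      assume "f \<in> V"
      show "(\<lambda>i. (w i)\<^sup>2 * (norm (orth_proj ip (W i \<inter> V) f))\<^sup>2) summable_on I \<and>
        A * (norm (adj_op ip K f))\<^sup>2 \<le> (\<Sum>\<^sub>\<infinity>i\<in>I. (w i)\<^sup>2 * (norm (orth_proj ip (W i \<inter> V) f))\<^sup>2) \<and>
        (\<Sum>\<^sub>\<infinity>i\<in>I. (w i)\<^sup>2 * (norm (orth_proj ip (W i \<inter> V) f))\<^sup>2) \<le> B * (norm f)\<^sup>2"
        unfolding cong[OF \<open>f \<in> V\<close>] using frame by (rule bspec) simp
    qed
  qed (use W V in \<open>auto intro: closed_subspace_Int\<close>)
qed

end
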